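(* Let $\mathcal{A}$ be an $n\times n$ sign pattern. If the digraph $D(\mathcal{A})$ is a directed $n$-cycle, with any number of vertices having a loop (that is, the arcs of $D(\mathcal{A})$ are exactly the arcs of a directed cycle through all $n$ vertices, together with an arbitrary, possibly empty, set of loops), then $\mathcal{A}$ requires the nSMP.
   Context: A real $n\times n$ matrix $A$ has the non-symmetric strong multiplicity property (nSMP) if the only real $n\times n$ matrix $X$ satisfying all of (1) $A\circ X=O$ (entrywise product), (2) $AX^T-X^TA=O$, and (3) $\mathrm{tr}(X^TA^k)=0$ for all $0\le k<n$, is $X=O$ (the zero matrix). A sign pattern is an $n\times n$ matrix $\mathcal{A}$ with entries in $\{+,-,0\}$; $Q(\mathcal{A})$ is the set of real $n\times n$ matrices $A$ with $A_{ij}>0$ if $\mathcal{A}_{ij}=+$, $A_{ij}<0$ if $\mathcal{A}_{ij}=-$, and $A_{ij}=0$ if $\mathcal{A}_{ij}=0$. The pattern $\mathcal{A}$ requires a property if every $A\in Q(\mathcal{A})$ has the property. The digraph $D(\mathcal{A})$ has vertices $v_1,\dots,v_n$ and an arc from $v_i$ to $v_j$ if and only if $\mathcal{A}_{ij}\ne 0$. A loop is an arc from a vertex to itself (a nonzero diagonal entry). A directed $k$-cycle consists of $k$ distinct vertices $u_1,\dots,u_k$ and the arcs $(u_1,u_2),\dots,(u_{k-1},u_k),(u_k,u_1)$. *)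

theory Defs
  imports "HOL-Analysis.Analysis" "Graph_Theory.Pair_Digraph"
begin

text \<open>
  On the type \<^typ>\<open>real^'n^'n\<close> the overloaded operations \<open>*\<close>, \<open>1\<close> and \<open>^\<close> are entrywise, so
  powers with respect to the matrix product \<open>**\<close> have to be introduced separately.
\<close>

primrec matrix_power :: "real^'n^'n \<Rightarrow> nat \<Rightarrow> real^'n^'n" where
  "matrix_power A 0 = mat 1"
| "matrix_power A (Suc k) = A ** matrix_power A k"

text \<open>
  The non-symmetric strong multiplicity property.  In the first condition \<open>A * X\<close> is the
  entrywise (Hadamard) product.
\<close>

definition nSMP :: "real^'n^'n \<Rightarrow> bool" where
  "nSMP A \<longleftrightarrow>
     (\<forall>X :: real^'n^'n.
        A * X = 0 \<and>
        A ** transpose X - transpose X ** A = 0 \<and>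
        (\<forall>k<CARD('n). trace (transpose X ** matrix_power A k) = 0)
        \<longrightarrow> X = 0)"

datatype sign_symbol = Positive | Negative | Zero

type_synonym 'n sign_pattern = "sign_symbol^'n^'n"

fun has_sign :: "real \<Rightarrow> sign_symbol \<Rightarrow> bool" where
  "has_sign x Positive \<longleftrightarrow> x > 0"
| "has_sign x Negative \<longleftrightarrow> x < 0"
| "has_sign x Zero \<longleftrightarrow> x = 0"

definition qualitative_class :: "'n::finite sign_pattern \<Rightarrow> (real^'n^'n) set" where
  "qualitative_class P = {A. \<forall>i j. has_sign (A $ i $ j) (P $ i $ j)}"

definition pattern_requires :: "'n::finite sign_pattern \<Rightarrow> (real^'n^'n \<Rightarrow> bool) \<Rightarrow> bool" where
  "pattern_requires P property \<longleftrightarrow> (\<forall>A \<in> qualitative_class P. property A)"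

definition pattern_digraph :: "'n::finite sign_pattern \<Rightarrow> 'n pair_pre_digraph" where
  "pattern_digraph P = \<lparr>pverts = UNIV, parcs = {(i, j). P $ i $ j \<noteq> Zero}\<rparr>"

text \<open>
  The library predicate \<^const>\<open>pre_digraph.cycle\<close> describes a directed cycle by its list of
  consecutive arcs (nonempty, closed, no repeated vertex); lengths 1 (a loop) and 2 are
  permitted.  A cycle with as many arcs as the digraph has vertices visits every vertex.
\<close>

definition is_spanning_cycle_with_loops :: "'v pair_pre_digraph \<Rightarrow> bool" where
  "is_spanning_cycle_with_loops D \<longleftrightarrow>
     (\<exists>p L. pre_digraph.cycle (with_proj D) p \<and> length p = card (pverts D) \<and>
            L \<subseteq> pverts D \<and> parcs D = set p \<union> {(v, v) | v. v \<in> L})"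

end

theory Submission
  imports Defs "HOL-Number_Theory.Cong"
begin

text \<open>
  Write \<open>s\<close> for the successor map of the cycle, and call \<open>M\<^sub>i\<^sub>,\<^sub>j\<close> with \<open>j = s\<^sup>r i\<close>, \<open>0 \<le> r < n\<close>, an entry
  of offset \<open>r\<close>.  The matrix \<open>A\<close> has entries of offsets 0 and 1 only, so for \<open>k < n\<close> the entries of
  \<open>A\<^sup>k\<close> have offset at most \<open>k\<close>; those of offset \<open>k\<close> are products of \<open>k\<close> consecutive arc weights
  and those of offset 0 are the \<open>A\<^sub>i\<^sub>i\<^sup>k\<close>.  Let \<open>B = X\<^sup>T\<close>, and suppose that \<open>m\<close> is the largest offset
  in \<open>B\<close>.  If \<open>m > 0\<close>, only offset \<open>m\<close> of \<open>B\<close> against offset \<open>n - m\<close> of \<open>A\<^bsup>n-m\<^esup>\<close> contributes to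
  \<open>tr (B A\<^bsup>n-m\<^esup>)\<close>, because the diagonal part vanishes by \<open>A \<circ> X = O\<close>; the relation \<open>AB = BA\<close> makes the
  \<open>n\<close> summands equal, so they are all 0, and offset \<open>m\<close> of \<open>B\<close> vanishes after all.  If \<open>m = 0\<close>,
  then \<open>B\<close> is scalar by \<open>AB = BA\<close> and \<open>tr B = 0\<close>.
\<close>

section \<open>Cyclic permutations of a finite index set\<close>

locale cyclic_successor =
  fixes s :: "'n::finite \<Rightarrow> 'n"
  assumes orbit_bij: "bij_betw (\<lambda>r. (s ^^ r) i) {..<CARD('n)} UNIV"
begin

lemma orbitE:
  obtains r where "r < CARD('n)" "j = (s ^^ r) i"
proof -
  have "j \<in> (\<lambda>r. (s ^^ r) i) ` {..<CARD('n)}"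
    using orbit_bij[of i] by (simp add: bij_betw_def)
  then show thesis using that by blast
qed

lemma funpow_eq_iff:
  "a < CARD('n) \<Longrightarrow> b < CARD('n) \<Longrightarrow> (s ^^ a) i = (s ^^ b) i \<longleftrightarrow> a = b"
  using orbit_bij[of i] by (auto simp: bij_betw_def inj_on_def)

lemma inj_s: "inj s"
proof -
  have "\<exists>x. y = s x" for y
  proof -
    \<comment> \<open>Starting the orbit at a value of \<open>s\<close> makes all its points values
      of \<open>s\<close>, even at \<open>r = 0\<close>.\<close>
    obtain r where "y = (s ^^ r) (s undefined)" by (rule orbitE)
    then have "y = s ((s ^^ r) undefined)" by (simp add: funpow_swap1)
    then show ?thesis by blast
  qed
  then have "surj s" by (simp add: surj_def)
  then show ?thesis by (simp add: finite_UNIV_surj_inj)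
qed

text \<open>The \<open>n\<close>-th iterate agrees with an \<open>r\<close>-th one,
  \<open>r < n\<close>. Cancelling the injective \<open>s ^^ r\<close> leaves
  \<open>s ^^ (n - r)\<close> fixing \<open>i\<close>, which for \<open>r > 0\<close> contradicts
  the distinctness of the first \<open>n\<close> iterates.\<close>

lemma funpow_card: "(s ^^ CARD('n)) i = i"
proof -
  obtain r where r: "r < CARD('n)" "(s ^^ CARD('n)) i = (s ^^ r) i" by (rule orbitE)
  have "(s ^^ r) ((s ^^ (CARD('n) - r)) i) = (s ^^ (r + (CARD('n) - r))) i"
    by (simp only: funpow_add o_apply)
  also have "\<dots> = (s ^^ r) i" using r by simp
  finally have "(s ^^ (CARD('n) - r)) i = (s ^^ 0) i"
    using inj_fn[OF inj_s] by (simp add: inj_eq)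
  then have "r = 0"
    using funpow_eq_iff[of "CARD('n) - r" 0 i] r(1) by (cases "r = 0") auto
  with r show ?thesis by simp
qed

lemma sum_orbit: "(\<Sum>j\<in>UNIV. f j) = (\<Sum>r<CARD('n). f ((s ^^ r) i))"
  using sum.reindex_bij_betw[OF orbit_bij[of i], of f] by simp

lemma const_if_invariant:
  assumes "\<And>i. f (s i) = f i"
  shows "f j = f i"
proof -
  have "f ((s ^^ r) i) = f i" for r by (induction r) (simp_all add: assms)
  moreover obtain r where "j = (s ^^ r) i" by (rule orbitE)
  ultimately show ?thesis by simp
qed

end

section \<open>Matrices supported on a cycle and the diagonal\<close>

locale looped_cycle_matrix = cyclic_successor s for s :: "'n::finite \<Rightarrow> 'n" +
  fixes A :: "real^'n^'n"
  assumes card_gt_1: "1 < CARD('n)"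
    and arc_nonzero: "A $ i $ s i \<noteq> 0"
    and nonarc_zero: "j \<noteq> i \<Longrightarrow> j \<noteq> s i \<Longrightarrow> A $ i $ j = 0"
begin

text \<open>Here \<open>n > 1\<close> keeps loops and cycle arcs apart, so that the two-term
  expansions below have distinct terms.\<close>

lemma s_neq: "s i \<noteq> i"
  using funpow_eq_iff[of 1 0 i] card_gt_1 by auto

lemma mult_left_entry: "(A ** M) $ i $ j = A $ i $ i * M $ i $ j + A $ i $ s i * M $ s i $ j"
proof -
  have "(A ** M) $ i $ j = (\<Sum>k\<in>{i, s i}. A $ i $ k * M $ k $ j)"
    unfolding matrix_matrix_mult_def
    by (simp, rule sum.mono_neutral_right) (auto simp: nonarc_zero)
  then show ?thesis using s_neq[of i] by simp
qed

lemma mult_right_entry: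
  "(M ** A) $ i $ s j = M $ i $ s j * A $ s j $ s j + M $ i $ j * A $ j $ s j"
proof -
  have "A $ k $ s j = 0" if "k \<noteq> j" "k \<noteq> s j" for k
    using that nonarc_zero[of "s j" k] inj_s by (auto simp: inj_eq)
  then have "(M ** A) $ i $ s j = (\<Sum>k\<in>{s j, j}. M $ i $ k * A $ k $ s j)"
    unfolding matrix_matrix_mult_def
    by (simp, intro sum.mono_neutral_right) auto
  then show ?thesis using s_neq[of j] by simp
qed

text \<open>Row \<open>i\<close> of the next power mixes rows \<open>i\<close> and
  \<open>s i\<close> of the current one; seen from \<open>s i\<close>, the target is one offset
  closer.\<close>

lemma power_entry_above:
  "k < r \<Longrightarrow> r < CARD('n) \<Longrightarrow> matrix_power A k $ i $ (s ^^ r) i = 0"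
proof (induction k arbitrary: r i)
  case 0
  then show ?case using funpow_eq_iff[of r 0 i] by (auto simp: mat_def)
next
  case (Suc k)
  then obtain r' where r': "r = Suc r'" by (cases r) auto
  have "matrix_power A k $ i $ (s ^^ r) i = 0" using Suc by simp
  moreover have "matrix_power A k $ s i $ (s ^^ r') (s i) = 0" using Suc r' by simp
  ultimately show ?case by (simp add: mult_left_entry r' funpow_swap1)
qed

lemma power_entry_top:
  "k < CARD('n) \<Longrightarrow> matrix_power A k $ i $ (s ^^ k) i = (\<Prod>j<k. A $ (s ^^ j) i $ s ((s ^^ j) i))"
proof (induction k arbitrary: i)
  case 0
  then show ?case by (simp add: mat_def)
next
  case (Suc k)
  have "matrix_power A k $ i $ (s ^^ Suc k) i = 0" using Suc.prems by (intro power_entry_above) auto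
  with Suc show ?case by (simp add: mult_left_entry prod.lessThan_Suc_shift funpow_swap1 del: prod.lessThan_Suc)
qed

lemma power_entry_diag:
  "k < CARD('n) \<Longrightarrow> matrix_power A k $ i $ i = (A $ i $ i) ^ k"
proof (induction k)
  case 0
  then show ?case by (simp add: mat_def)
next
  case (Suc k)
  \<comment> \<open>Seen from \<open>s i\<close>, the point \<open>i\<close> has offset
    \<open>n - 1\<close>, still out of reach of \<open>k < n - 1\<close> steps.\<close>
  have "(s ^^ (CARD('n) - 1)) (s i) = (s ^^ Suc (CARD('n) - 1)) i" by (simp only: funpow_Suc_right o_apply)
  also have "\<dots> = i" using funpow_card card_gt_1 by simp
  finally have "matrix_power A k $ s i $ i = 0"
    using power_entry_above[of k "CARD('n) - 1" "s i"] Suc.prems by simp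
  with Suc show ?case by (simp add: mult_left_entry)
qed

text \<open>Compare the entries of \<open>A ** B\<close> and \<open>B ** A\<close> at row
  \<open>i\<close> and offset \<open>m + 1\<close>.\<close>

lemma commuting_offset_step:
  assumes comm: "A ** B = B ** A"
    and m: "m < CARD('n)"
    and above: "\<And>r i. m < r \<Longrightarrow> r < CARD('n) \<Longrightarrow> B $ i $ (s ^^ r) i = 0"
  shows "A $ i $ s i * B $ s i $ (s ^^ m) (s i)
    = A $ (s ^^ m) i $ s ((s ^^ m) i) * B $ i $ (s ^^ m) i"
proof -
  let ?j = "(s ^^ m) i"
  \<comment> \<open>The loop contributions cancel: below \<open>n\<close>, offset
    \<open>m + 1\<close> of \<open>B\<close> vanishes; at \<open>n\<close> it wraps round to the
    diagonal, where both products coincide.\<close>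
  have "A $ i $ i * B $ i $ s ?j = B $ i $ s ?j * A $ s ?j $ s ?j"
  proof (cases "Suc m < CARD('n)")
    case True
    then have "B $ i $ s ?j = 0" using above[of "Suc m" i] by simp
    then show ?thesis by simp
  next
    case False
    then have "Suc m = CARD('n)" using m by simp
    then have "s ?j = i" using funpow_card[of i] by (metis comp_apply funpow.simps(2))
    then show ?thesis by simp
  qed
  moreover have "(A ** B) $ i $ s ?j = (B ** A) $ i $ s ?j" using comm by simp
  ultimately have "A $ i $ s i * B $ s i $ s ?j = A $ ?j $ s ?j * B $ i $ ?j"
    unfolding mult_left_entry mult_right_entry by (simp only: mult.commute)
  then show ?thesis by (simp add: funpow_swap1)
qed

lemma offset_zero:
  assumes comm: "A ** B = B ** A"
    and diag: "\<And>i. A $ i $ i * B $ i $ i = 0"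
    and tr: "\<And>k. k < CARD('n) \<Longrightarrow> trace (B ** matrix_power A k) = 0"
    and m: "m < CARD('n)"
    and above: "\<And>r i. m < r \<Longrightarrow> r < CARD('n) \<Longrightarrow> B $ i $ (s ^^ r) i = 0"
  shows "B $ i $ (s ^^ m) i = 0"
proof (cases "m = 0")
  case True
  have step: "B $ s i $ s i = B $ i $ i" for i
    using commuting_offset_step[OF comm m above, of i] arc_nonzero[of i] True by simp
  have "(\<Sum>j\<in>UNIV. B $ j $ j) = (\<Sum>j\<in>(UNIV :: 'n set). B $ i $ i)"
    using const_if_invariant[of "\<lambda>i. B $ i $ i", OF step] by (intro sum.cong) auto
  moreover have "(\<Sum>j\<in>UNIV. B $ j $ j) = 0"
    using tr[of 0] by (simp add: trace_def matrix_mul_rid)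
  ultimately show ?thesis using True by simp
next
  case False
  define k where "k = CARD('n) - m"
  have k: "0 < k" "k < CARD('n)" "k + m = CARD('n)" using False m by (auto simp: k_def)
  define wt where "wt i = A $ i $ s i" for i
  \<comment> \<open>\<open>f i\<close> is the weight of a closed tour: one jump of \<open>m\<close>
    steps by \<open>B\<close>, then \<open>k\<close> arcs of \<open>A\<close> back to
    \<open>i\<close>.\<close>
  define f where "f i = B $ i $ (s ^^ m) i * (\<Prod>j<k. wt ((s ^^ j) ((s ^^ m) i)))" for i
  obtain l where l: "k = Suc l" using k(1) by (cases k) auto
  \<comment> \<open>Moving the base point to \<open>s i\<close> drops the arc weight at
    \<open>(s ^^ m) i\<close> and gains the one at \<open>i\<close>;
    \<open>commuting_offset_step\<close> compensates exactly this exchange.\<close>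
  have f_step: "f (s i) = f i" for i
  proof -
    define Q where "Q = (\<Prod>j<l. wt ((s ^^ j) ((s ^^ m) (s i))))"
    have "(s ^^ l) ((s ^^ m) (s i)) = (s ^^ (l + m)) (s i)"
      by (simp add: funpow_add)
    also have "\<dots> = (s ^^ CARD('n)) i" using k(3) l by (metis add_Suc comp_apply funpow_Suc_right)
    finally have last: "(s ^^ l) ((s ^^ m) (s i)) = i" by (simp add: funpow_card)
    have "f (s i) = (wt i * B $ s i $ (s ^^ m) (s i)) * Q"
      by (simp add: f_def l Q_def last)
    also have "wt i * B $ s i $ (s ^^ m) (s i) = wt ((s ^^ m) i) * B $ i $ (s ^^ m) i"
      unfolding wt_def by (rule commuting_offset_step[OF comm m above])
    finally show ?thesis
      by (simp add: f_def l Q_def prod.lessThan_Suc_shift funpow_swap1 del: prod.lessThan_Suc)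
  qed
  have row: "(\<Sum>j\<in>UNIV. B $ i $ j * matrix_power A k $ j $ i) = f i" for i
  proof -
    have orbit_closes: "i = (s ^^ (CARD('n) - r)) ((s ^^ r) i)" if "r < CARD('n)" for r
      using that funpow_card[of i] funpow_add[of "CARD('n) - r" r s] by simp
    let ?t = "\<lambda>r. B $ i $ (s ^^ r) i * matrix_power A k $ (s ^^ r) i $ i"
    have zero: "?t r = 0" if r: "r < CARD('n)" "r \<noteq> m" for r
    proof -
      \<comment> \<open>For \<open>r = 0\<close> a factor \<open>A $ i $ i\<close> survives since
        \<open>k > 0\<close>, and \<open>diag\<close> applies. For \<open>0 < r < m\<close> the way
        back has \<open>n - r > k\<close> steps, too many for the \<open>k\<close>-th power. Beyond
        \<open>m\<close>, \<open>B\<close> vanishes.\<close>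
      consider "r = 0" | "0 < r" "r < m" | "m < r" using r(2) by linarith
      then show ?thesis
      proof cases
        case 1
        then show ?thesis using diag[of i] k by (auto simp: power_entry_diag)
      next
        case 2
        then have "matrix_power A k $ (s ^^ r) i $ (s ^^ (CARD('n) - r)) ((s ^^ r) i) = 0"
          using k by (intro power_entry_above) auto
        then show ?thesis using orbit_closes[OF r(1)] by simp
      next
        case 3
        then show ?thesis using above r by simp
      qed
    qed
    have "(\<Sum>j\<in>UNIV. B $ i $ j * matrix_power A k $ j $ i) = (\<Sum>r<CARD('n). ?t r)"
      by (rule sum_orbit)
    also have "\<dots> = (\<Sum>r\<in>{m}. ?t r)"
      using m zero by (intro sum.mono_neutral_right) auto
    also have "\<dots> = f i"
      using power_entry_top[OF k(2), of "(s ^^ m) i"] orbit_closes[OF m] by (simp add: f_def wt_def k_def)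
    finally show ?thesis .
  qed
  have "0 = trace (B ** matrix_power A k)" using tr k by simp
  also have "\<dots> = (\<Sum>j\<in>UNIV. f j)" by (simp add: trace_def matrix_matrix_mult_def row)
  also have "\<dots> = (\<Sum>j\<in>(UNIV :: 'n set). f i)"
    using const_if_invariant[of f, OF f_step] by (intro sum.cong) auto
  finally have "f i = 0" by simp
  then show ?thesis using arc_nonzero by (simp add: f_def wt_def)
qed

lemma commuting_traceless_eq_0:
  assumes comm: "A ** B = B ** A"
    and diag: "\<And>i. A $ i $ i * B $ i $ i = 0"
    and tr: "\<And>k. k < CARD('n) \<Longrightarrow> trace (B ** matrix_power A k) = 0"
  shows "B = 0"
proof -
  \<comment> \<open>The lower bound \<open>0\<close> is the induction variable, descending from
    \<open>n\<close>, where the claim is vacuous.\<close>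
  have "\<forall>r i. 0 \<le> r \<longrightarrow> r < CARD('n) \<longrightarrow> B $ i $ (s ^^ r) i = 0"
  proof (rule inc_induct[of 0 "CARD('n)"])
    fix m assume m: "m < CARD('n)"
      and IH: "\<forall>r i. Suc m \<le> r \<longrightarrow> r < CARD('n) \<longrightarrow> B $ i $ (s ^^ r) i = 0"
    have "B $ i $ (s ^^ m) i = 0" for i
      by (rule offset_zero[OF comm diag tr m]) (simp_all add: IH)
    then have "B $ i $ (s ^^ r) i = 0" if "m \<le> r" "r < CARD('n)" for r i
      using IH that by (cases "r = m") auto
    then show "\<forall>r i. m \<le> r \<longrightarrow> r < CARD('n) \<longrightarrow> B $ i $ (s ^^ r) i = 0" by blast
  qed auto
  then have zero: "r < CARD('n) \<Longrightarrow> B $ i $ (s ^^ r) i = 0" for r i by simp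
  have "B $ i $ j = 0" for i j
  proof -
    obtain r where "r < CARD('n)" "j = (s ^^ r) i" by (rule orbitE)
    then show ?thesis using zero by simp
  qed
  then show ?thesis by (simp add: vec_eq_iff)
qed

lemma nSMP: "nSMP A"
  unfolding nSMP_def
proof (intro allI impI, elim conjE)
  fix X :: "real^'n^'n"
  assume had: "A * X = 0" and "A ** transpose X - transpose X ** A = 0"
    and "\<forall>k<CARD('n). trace (transpose X ** matrix_power A k) = 0"
  moreover have "A $ i $ i * transpose X $ i $ i = 0" for i
  proof -
    have "(A * X) $ i $ i = 0" using had by simp
    then show ?thesis by (simp add: transpose_def)
  qed
  ultimately have "transpose X = 0" by (intro commuting_traceless_eq_0) auto
  then show "X = 0" by (simp add: vec_eq_iff transpose_def)
qed

end

text \<open>The cycle is now itself a loop, and the trace condition for \<open>k = 0\<close> reads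
  off the only entry of \<open>X\<close>.\<close>

lemma nSMP_of_card_eq_1:
  fixes A :: "real^'n^'n"
  assumes "CARD('n) = 1"
  shows "nSMP A"
  unfolding nSMP_def
proof (intro allI impI, elim conjE)
  fix X :: "real^'n^'n"
  assume "\<forall>k<CARD('n). trace (transpose X ** matrix_power A k) = 0"
  then have "trace (transpose X ** matrix_power A 0) = 0" using assms by simp
  then have tr: "(\<Sum>i\<in>UNIV. X $ i $ i) = 0" by (simp add: trace_def transpose_def matrix_mul_rid)
  obtain a where U: "(UNIV :: 'n set) = {a}" using assms by (auto simp: card_1_singleton_iff)
  have all_a: "x = a" for x using U by auto
  have "X $ i $ j = 0" for i j using tr all_a[of i] all_a[of j] by (simp add: U)
  then show "X = 0" by (simp add: vec_eq_iff)
qed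

section \<open>From a list of arcs to a successor map\<close>

lemma spanning_cycle_vertices:
  fixes D :: "'n::finite pair_pre_digraph"
  assumes "is_spanning_cycle_with_loops D" "pverts D = UNIV"
  obtains v :: "nat \<Rightarrow> 'n" where
    "bij_betw v {..<CARD('n)} UNIV" "\<And>k. v (k mod CARD('n)) = v k"
    "\<And>k. (v k, v (Suc k)) \<in> parcs D"
    "\<And>i j. (i, j) \<in> parcs D \<Longrightarrow> i \<noteq> j \<Longrightarrow> \<exists>k. i = v k \<and> j = v (Suc k)"
proof -
  let ?n = "CARD('n)"
  obtain p L where cyc: "pre_digraph.cycle (with_proj D) p" and len: "length p = ?n"
    and arcs: "parcs D = set p \<union> {(v, v) | v. v \<in> L}"
    using assms unfolding is_spanning_cycle_with_loops_def by auto
  obtain u where walk: "pcas u p u" and dist: "distinct (tl (pawalk_verts u p))" and "p \<noteq> []"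
    using cyc by (auto simp: pre_digraph.cycle_def pre_digraph.awalk_def cas_with_proj_eq
        awalk_verts_with_proj_eq)
  have verts: "tl (pawalk_verts x q) = map snd q" if "pcas x q y" for x q y
    using that
  proof (induction q arbitrary: x)
    case (Cons e q)
    then show ?case by (cases q) auto
  qed auto
  have nth: "fst (q ! k) = (if k = 0 then x else snd (q ! (k - 1)))"
    if "pcas x q y" "k < length q" for x q y k
    using that
  proof (induction q arbitrary: x k)
    case (Cons e q)
    then show ?case by (cases k) (auto simp: nth_Cons' split: if_splits)
  qed auto
  have last: "y = snd (last q)" if "pcas x q y" "q \<noteq> []" for x q y
    using that by (induction q arbitrary: x) (auto split: if_splits)
  \<comment> \<open>Vertices are numbered by heads of arcs, since these form the tail of the vertex
    list, which a cycle makes distinct. Hence the arc from \<open>v k\<close> to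
    \<open>v (Suc k)\<close> has index \<open>k + 1\<close>. Periodic indexing absorbs the closing
    arc.\<close>
  define v where "v k = snd (p ! (k mod ?n))" for k
  have dist': "distinct (map snd p)" using dist verts[OF walk] by simp
  have arc: "p ! (Suc k mod ?n) = (v k, v (Suc k))" for k
  proof -
    have "fst (p ! (Suc k mod ?n)) = v k"
    proof (cases "Suc (k mod ?n) = ?n")
      case True
      then have "Suc k mod ?n = 0" by (simp add: mod_Suc)
      moreover have "k mod ?n = length p - 1" using True len by simp
      ultimately show ?thesis
        using nth[OF walk, of 0] last[OF walk \<open>p \<noteq> []\<close>] \<open>p \<noteq> []\<close> by (simp add: v_def last_conv_nth)
    next
      case False
      then have "Suc k mod ?n = Suc (k mod ?n)" by (simp add: mod_Suc)
      moreover have "Suc k mod ?n < length p" by (simp add: len)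
      ultimately show ?thesis using nth[OF walk, of "Suc k mod ?n"] by (simp add: v_def)
    qed
    then show ?thesis by (simp add: v_def prod_eq_iff)
  qed
  show thesis
  proof
    have "inj_on v {..<?n}"
      using dist' len by (auto simp: inj_on_def v_def distinct_conv_nth)
    moreover from this have "v ` {..<?n} = UNIV"
      by (intro card_eq_UNIV_imp_eq_UNIV) (auto simp: card_image)
    ultimately show "bij_betw v {..<?n} UNIV" by (simp add: bij_betw_def)
    show "v (k mod ?n) = v k" for k by (simp add: v_def)
    show "(v k, v (Suc k)) \<in> parcs D" for k
      using arc[of k] len nth_mem[of "Suc k mod ?n" p] by (simp add: arcs)
    show "\<exists>k. i = v k \<and> j = v (Suc k)" if "(i, j) \<in> parcs D" "i \<noteq> j" for i j
    proof -
      have "(i, j) \<in> set p" using that arcs by auto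
      then obtain l where l: "l < ?n" "p ! l = (i, j)" by (auto simp: in_set_conv_nth len)
      \<comment> \<open>This is \<open>l - 1\<close> modulo \<open>n\<close>, shifted by
        \<open>n\<close> to stay natural at \<open>l = 0\<close>.\<close>
      define k where "k = l + (?n - 1)"
      have "Suc k = l + ?n" by (simp add: k_def)
      then have "Suc k mod ?n = l" using l by simp
      then show ?thesis using arc[of k] l by auto
    qed
  qed
qed

lemma spanning_cycle_successor:
  fixes D :: "'n::finite pair_pre_digraph"
  assumes "is_spanning_cycle_with_loops D" "pverts D = UNIV"
  obtains s where "cyclic_successor s" "\<forall>i. (i, s i) \<in> parcs D"
    "\<forall>i j. (i, j) \<in> parcs D \<longrightarrow> j \<noteq> i \<longrightarrow> j = s i"
proof -
  let ?n = "CARD('n)"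
  obtain v :: "nat \<Rightarrow> 'n" where bij: "bij_betw v {..<?n} UNIV"
    and per: "\<And>k. v (k mod ?n) = v k"
    and arc: "\<And>k. (v k, v (Suc k)) \<in> parcs D"
    and only: "\<And>i j. (i, j) \<in> parcs D \<Longrightarrow> i \<noteq> j \<Longrightarrow> \<exists>k. i = v k \<and> j = v (Suc k)"
    using spanning_cycle_vertices[OF assms] by metis
  have v_eq: "v a = v b \<longleftrightarrow> a mod ?n = b mod ?n" for a b
    using bij per[of a] per[of b]
    by (metis bij_betw_def inj_on_def lessThan_iff mod_less_divisor zero_less_card_finite)
  have v_surj: "\<exists>k. i = v k" for i using bij by (auto simp: bij_betw_def)
  \<comment> \<open>The choice of index is harmless: by \<open>v_eq\<close>, indices of one vertex
    are congruent modulo \<open>n\<close>, and so are their successors.\<close>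
  define s where "s i = v (Suc (SOME k. i = v k))" for i
  have s_v: "s (v k) = v (Suc k)" for k
  proof -
    have "v k = v (SOME l. v k = v l)" by (rule someI[of _ k]) simp
    then show ?thesis unfolding s_def v_eq by (metis mod_Suc_eq)
  qed
  have funpow_v: "(s ^^ r) (v k) = v (r + k)" for r k by (induction r) (simp_all add: s_v)
  show thesis
  proof
    show "cyclic_successor s"
    proof
      fix i
      obtain k where k: "i = v k" using v_surj by blast
      have "inj_on (\<lambda>r. (s ^^ r) i) {..<?n}"
      proof (rule inj_onI)
        fix a b assume ab: "a \<in> {..<?n}" "b \<in> {..<?n}" "(s ^^ a) i = (s ^^ b) i"
        then have "[a + k = b + k] (mod ?n)" by (simp add: k funpow_v v_eq cong_def)
        then have "[a = b] (mod ?n)" by (simp add: cong_add_rcancel_nat)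
        then show "a = b" using ab by (simp add: cong_def)
      qed
      moreover from this have "(\<lambda>r. (s ^^ r) i) ` {..<?n} = UNIV"
        by (intro card_eq_UNIV_imp_eq_UNIV) (auto simp: card_image)
      ultimately show "bij_betw (\<lambda>r. (s ^^ r) i) {..<?n} UNIV" by (simp add: bij_betw_def)
    qed
    show "\<forall>i. (i, s i) \<in> parcs D" using v_surj arc s_v by metis
    show "\<forall>i j. (i, j) \<in> parcs D \<longrightarrow> j \<noteq> i \<longrightarrow> j = s i" using only s_v by metis
  qed
qed

theorem theorem3p3:
  fixes P :: "'n::finite sign_pattern"
  assumes "is_spanning_cycle_with_loops (pattern_digraph P)"
  shows "pattern_requires P nSMP"
  unfolding pattern_requires_def
proof
  fix A assume "A \<in> qualitative_class P"
  then have sgn: "has_sign (A $ i $ j) (P $ i $ j)" for i j by (simp add: qualitative_class_def)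
  have nz: "A $ i $ j \<noteq> 0 \<longleftrightarrow> P $ i $ j \<noteq> Zero" for i j
    using sgn[of i j] by (cases "P $ i $ j") auto
  show "nSMP A"
  proof (cases "CARD('n) = 1")
    case True
    then show ?thesis by (rule nSMP_of_card_eq_1)
  next
    case False
    then have "1 < CARD('n)" using zero_less_card_finite[where 'a = 'n] by linarith
    have "pverts (pattern_digraph P) = UNIV" by (simp add: pattern_digraph_def)
    then obtain s where s: "cyclic_successor s"
      and arc: "\<forall>i. (i, s i) \<in> parcs (pattern_digraph P)"
      and only: "\<forall>i j. (i, j) \<in> parcs (pattern_digraph P) \<longrightarrow> j \<noteq> i \<longrightarrow> j = s i"
      by (rule spanning_cycle_successor[OF assms])
    interpret cyclic_successor s by (fact s)
    have "looped_cycle_matrix s A"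
    proof
      show "1 < CARD('n)" by fact
      show "A $ i $ s i \<noteq> 0" for i using arc by (simp add: pattern_digraph_def nz)
      show "A $ i $ j = 0" if "j \<noteq> i" "j \<noteq> s i" for i j
        using only that nz[of i j] by (auto simp: pattern_digraph_def)
    qed
    then show ?thesis by (rule looped_cycle_matrix.nSMP)
  qed
qed

end
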